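(* Let $\mathcal{C} \subseteq \mathcal{I}_{\mathrm{P}}$ and let $k_i \in \{1,\dots,K-1\}$ for each $i \in \mathcal{I}_{\mathrm{P}} \setminus \mathcal{C}$. If $\mathcal{I}_{\mathrm{F}} \neq \varnothing$, then the inequality $$\eta \le 1 - p_{\mathcal{C}} + p_{\mathcal{C}} \left( \sum_{i \in \mathcal{I}_{\mathrm{P}} \setminus \mathcal{C}} h_{i,k_i}(y_i, z_i) + \sum_{i \in \mathcal{C}} p_i (y_i - z_i) + \sum_{i \in \mathcal{I}_{\mathrm{F}}} z_i \right)$$ is facet-defining for $\operatorname{conv}(\mathcal{X})$.
   Context: $\mathcal{I}$ is a finite set, $K \ge 2$ is an integer, and $p_i \in [0,1]$ for each $i \in \mathcal{I}$. Put $\mathcal{I}_{\mathrm{P}} = \{i \in \mathcal{I} : 0 \le p_i < 1\}$ and $\mathcal{I}_{\mathrm{F}} = \{i \in \mathcal{I} : p_i = 1\}$. The convention $0^0 = 1$ is used. Define $$\mathcal{X} = \Big\{(\eta,y,z) \in \mathbb{R} \times \mathbb{Z}_{\ge 0}^{|\mathcal{I}|} \times \{0,1\}^{|\mathcal{I}|} : \eta \le 1 - \prod_{i \in \mathcal{I}} (1-p_i)^{y_i},\ z_i \le y_i \le K z_i \ \text{for all } i \in \mathcal{I}\Big\},$$ and let $\operatorname{conv}(\mathcal{X})$ be its convex hull. For $\mathcal{C} \subseteq \mathcal{I}_{\mathrm{P}}$, $p_{\mathcal{C}} := \prod_{i \in \mathcal{C}} (1-p_i)$, with $p_{\varnothing}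 := 1$. For $i \in \mathcal{I}_{\mathrm{P}}$ and $k \in \{1,\dots,K-1\}$, $$h_{i,k}(y_i,z_i) := p_i (1-p_i)^k y_i + \left(1 - (1-p_i)^k (k p_i + 1)\right) z_i .$$ An inequality is facet-defining for $\operatorname{conv}(\mathcal{X})$ if it is valid for $\operatorname{conv}(\mathcal{X})$ and the set of points of $\operatorname{conv}(\mathcal{X})$ satisfying it with equality is a proper face of dimension $\dim(\operatorname{conv}(\mathcal{X})) - 1$. *)

theory Defs
  imports "HOL-Analysis.Analysis"
begin

text \<open>
  The finite index set is rendered as a finite type \<open>'i\<close>, so the ambient space of the triples
  \<open>(\<eta>, y, z)\<close> is the Euclidean space \<open>real \<times> (real ^ 'i) \<times> (real ^ 'i)\<close>.
\<close>

definition idx_P :: "('i \<Rightarrow> real) \<Rightarrow> 'i set" where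
  "idx_P p = {i. 0 \<le> p i \<and> p i < 1}"

definition idx_F :: "('i \<Rightarrow> real) \<Rightarrow> 'i set" where
  "idx_F p = {i. p i = 1}"

text \<open>
  The integer vectors are taken over \<open>nat\<close> and embedded into \<open>real ^ 'i\<close>, so that the exponent
  below is a natural number and \<open>0 ^ 0 = 1\<close> holds as required.
\<close>

definition feas_set :: "('i::finite \<Rightarrow> real) \<Rightarrow> nat \<Rightarrow> (real \<times> (real ^ 'i) \<times> (real ^ 'i)) set" where
  "feas_set p K =
    {(\<eta>, (\<chi> i. real (y i)), (\<chi> i. real (z i))) | (\<eta> :: real) (y :: 'i \<Rightarrow> nat) (z :: 'i \<Rightarrow> nat).
       (\<forall>i. z i \<in> {0, 1}) \<and>
       \<eta> \<le> 1 - (\<Prod>i\<in>UNIV. (1 - p i) ^ y i) \<and>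
       (\<forall>i. z i \<le> y i \<and> y i \<le> K * z i)}"

definition prod_compl :: "('i \<Rightarrow> real) \<Rightarrow> 'i set \<Rightarrow> real" where
  "prod_compl p C = (\<Prod>i\<in>C. 1 - p i)"

definition h_fun :: "('i \<Rightarrow> real) \<Rightarrow> 'i \<Rightarrow> nat \<Rightarrow> real \<Rightarrow> real \<Rightarrow> real" where
  "h_fun p i k u v =
     p i * (1 - p i) ^ k * u + (1 - (1 - p i) ^ k * (real k * p i + 1)) * v"

text \<open>
  The inequality \<open>f \<le> g\<close> is facet-defining for \<open>S\<close>. The library's \<open>facet_of\<close> says that the
  equality set is a nonempty face of affine dimension \<open>aff_dim S - 1\<close>, so that face is proper.
\<close>

definition facet_defining ::
    "'a::euclidean_space set \<Rightarrow> ('a \<Rightarrow> real) \<Rightarrow> ('a \<Rightarrow> real) \<Rightarrow> bool" where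
  "facet_defining S f g \<longleftrightarrow> (\<forall>x\<in>S. f x \<le> g x) \<and> {x \<in> S. f x = g x} facet_of S"

end

theory Submission
  imports Defs
begin

text \<open>
  Write the right-hand side as \<open>1 - p\<^sub>C + p\<^sub>C * (\<Sum>i. c\<^sub>i(y\<^sub>i, z\<^sub>i))\<close>, one term for every item.

  Validity. Put \<open>w\<^sub>i = 1 - p\<^sub>i\<close> for \<open>i \<in> C\<close> and \<open>w\<^sub>i = 1\<close> otherwise, so that \<open>p\<^sub>C = \<Prod>i. w\<^sub>i\<close>. Every
  item satisfies \<open>(1 - p\<^sub>i)^y\<^sub>i \<ge> w\<^sub>i * (1 - c\<^sub>i(y\<^sub>i, z\<^sub>i))\<close> (\<open>term_bounds\<close>): for selected
  items with \<open>p\<^sub>i < 1\<close> this says that the convex function \<open>u \<mapsto> (1 - p\<^sub>i)^u\<close> does not lie, at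
  integers, below the line of its chord between two consecutive integers (\<open>power_ge_chord\<close>). Multiplying over all items and using
  Weierstrass' inequality \<open>\<Prod>i. (1 - c\<^sub>i) \<ge> 1 - (\<Sum>i. c\<^sub>i)\<close> gives
  \<open>\<Prod>i. (1 - p\<^sub>i)^y\<^sub>i \<ge> p\<^sub>C * (1 - (\<Sum>i. c\<^sub>i))\<close>, which is the claim (\<open>lhs_valid\<close>).

  Dimension. At the base point \<open>y = z = 1\<^sub>C\<close> both inequalities are equalities, with every \<open>c\<^sub>i = 0\<close>.
  They remain so when one item alone is moved to an endpoint of its chord, because at most one \<open>c\<^sub>i\<close>
  is then nonzero (\<open>tight_one_change\<close>). Equality also holds when both sides vanish: an item \<open>f\<close>
  with \<open>p\<^sub>f = 1\<close> and \<open>z\<^sub>f = 1\<close> makes the product zero and contributes \<open>c\<^sub>f = 1\<close>, and then an item of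
  \<open>C\<close> may be dropped (\<open>tight_sure_change\<close>). This is where \<open>idx_F p \<noteq> {}\<close> enters: dropping an item \<open>i\<close>
  with \<open>p\<^sub>i > 0\<close> from the base point itself breaks equality. Up to the \<open>\<eta>\<close>-direction, differences of
  these tight points produce all coordinate axes (\<open>axes_in_tight_span\<close>), so the tight points
  affinely span a hyperplane.
\<close>

section \<open>A criterion for facets of a convex hull\<close>

text \<open>
  The exposed face \<open>l = b\<close> is proper because of \<open>x0\<close>, so its affine dimension is smaller than that of
  the hull, which is at most the dimension of the space. The spanning condition gives the opposite
  bound: one extra vector \<open>e\<close> completes the directions of the face to the whole space. Both
  dimensions are thereby determined at once; in particular the hull is full-dimensional.
\<close>

lemma facet_of_convex_hull_linear:
  fixes X :: "'a::euclidean_space set" and l :: "'a \<Rightarrow> real"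
  assumes l: "linear l"
    and valid: "\<And>x. x \<in> X \<Longrightarrow> l x \<le> b"
    and strict: "x0 \<in> X" "l x0 < b"
    and tight: "a \<in> X" "l a = b"
    and span: "span (insert e ((\<lambda>x. x - a) ` {x \<in> X. l x = b})) = UNIV"
  shows "\<forall>x \<in> convex hull X. l x \<le> b"
    and "{x \<in> convex hull X. l x = b} facet_of (convex hull X)"
proof -
  define n where "n = adjoint l 1"
  have n: "n \<bullet> x = l x" for x
    using adjoint_works[OF l, of x 1] by (simp add: n_def inner_commute)
  have "convex hull X \<subseteq> {x. n \<bullet> x \<le> b}"
    using valid by (intro hull_minimal convex_halfspace_le) (auto simp: n)
  then show le: "\<forall>x \<in> convex hull X. l x \<le> b"
    by (auto simp: n)
  define F where "F = {x \<in> convex hull X. l x = b}"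
  have "(convex hull X \<inter> {x. n \<bullet> x = b}) face_of convex hull X"
    using le by (intro face_of_Int_supporting_hyperplane_le) (auto simp: n)
  also have "convex hull X \<inter> {x. n \<bullet> x = b} = F"
    by (auto simp: F_def n)
  finally have face: "F face_of convex hull X" .
  have aF: "a \<in> F" and TF: "{x \<in> X. l x = b} \<subseteq> F"
    using tight hull_subset[of X convex] by (auto simp: F_def)
  have "F \<noteq> convex hull X"
    using strict hull_inc[of x0 X convex] by (force simp: F_def)
  then have less: "aff_dim F < aff_dim (convex hull X)"
    using face by (intro face_of_aff_dim_lt) auto
  have "DIM('a) = dim (insert e ((\<lambda>x. x - a) ` {x \<in> X. l x = b}))"
    by (metis span dim_span dim_UNIV)
  also have "\<dots> \<le> dim (insert e ((\<lambda>x. x - a) ` F))"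
    using TF by (intro dim_subset) auto
  also have "\<dots> \<le> dim ((\<lambda>x. x - a) ` F) + 1"
    by (simp add: dim_insert)
  finally have "int (DIM('a)) \<le> aff_dim F + 1"
    using aff_dim_eq_dim_subtract[of a F] aF hull_inc[of a F affine] by simp
  with less aff_dim_le_DIM[of "convex hull X"]
  have "aff_dim F = aff_dim (convex hull X) - 1" by linarith
  with face aF show "{x \<in> convex hull X. l x = b} facet_of (convex hull X)"
    unfolding facet_of_def F_def[symmetric] by auto
qed

section \<open>Two elementary inequalities\<close>

text \<open>
  The line \<open>u \<mapsto> (1 - t)^k * (1 + t * (k - u))\<close> meets \<open>u \<mapsto> (1 - t)^u\<close> at \<open>u = k\<close> and \<open>u = k + 1\<close>; there
  is no integer between these two points, so convexity puts the line on or below the curve at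
  every integer. On either side of the chord the claim is an instance of Bernoulli's inequality.
\<close>

lemma power_ge_chord:
  fixes t :: real
  assumes "0 \<le> t" "t \<le> 1"
  shows "(1 - t) ^ k * (1 + t * (real k - real y)) \<le> (1 - t) ^ y"
proof (cases "k \<le> y")
  case True
  define m where "m = y - k"
  have y: "y = k + m" using True by (simp add: m_def)
  have "1 + real m * (- t) \<le> (1 + (- t)) ^ m"
    using assms by (intro Bernoulli_inequality) auto
  then have "(1 - t) ^ k * (1 - t * real m) \<le> (1 - t) ^ k * (1 - t) ^ m"
    using assms by (intro mult_left_mono) (auto simp: mult.commute)
  then show ?thesis by (simp add: y power_add)
next
  case False
  define m where "m = k - y"
  have k: "k = y + m" using False by (simp add: m_def)
  have "(1 - t) ^ m * (1 + t * real m) \<le> (1 - t) ^ m * (1 + t) ^ m"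
    using assms Bernoulli_inequality[of t m]
    by (intro mult_left_mono) (auto simp: mult.commute)
  also have "\<dots> = (1 - t\<^sup>2) ^ m"
    by (simp add: power_mult_distrib[symmetric] algebra_simps power2_eq_square)
  also have "\<dots> \<le> 1"
    using assms by (intro power_le_one) (auto simp: power2_eq_square mult_le_one)
  finally have "(1 - t) ^ y * ((1 - t) ^ m * (1 + t * real m)) \<le> (1 - t) ^ y * 1"
    using assms by (intro mult_left_mono) auto
  then show ?thesis by (simp add: k power_add mult.assoc)
qed

text \<open>
  Weierstrass' inequality requires summands in the unit interval. A summand above \<open>1\<close> can be
  replaced by \<open>1\<close>, since the corresponding lower bound on the nonnegative factor \<open>x i\<close> was vacuous.
\<close>

lemma prod_ge_weighted_one_minus_sum:
  fixes x w c :: "'a \<Rightarrow> real"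
  assumes "\<And>i. i \<in> A \<Longrightarrow> 0 \<le> x i" "\<And>i. i \<in> A \<Longrightarrow> 0 \<le> w i" "\<And>i. i \<in> A \<Longrightarrow> 0 \<le> c i"
    and "\<And>i. i \<in> A \<Longrightarrow> w i * (1 - c i) \<le> x i"
  shows "prod w A * (1 - sum c A) \<le> prod x A"
proof -
  have "1 - sum c A \<le> 1 - (\<Sum>i\<in>A. min (c i) 1)"
    using sum_mono[of A "\<lambda>i. min (c i) 1" c] by simp
  also have "\<dots> \<le> (\<Prod>i\<in>A. 1 - min (c i) 1)"
    using assms by (intro Weierstrass_prod_ineq) auto
  finally have "prod w A * (1 - sum c A) \<le> (\<Prod>i\<in>A. w i * (1 - min (c i) 1))"
    using assms by (simp add: prod.distrib mult_left_mono prod_nonneg)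
  also have "\<dots> \<le> prod x A"
    using assms by (intro prod_mono) (auto simp: min_def)
  finally show ?thesis .
qed

section \<open>The inequality term by term\<close>

definition admissible :: "nat \<Rightarrow> nat \<Rightarrow> nat \<Rightarrow> bool" where
  "admissible K u v \<longleftrightarrow> v \<in> {0, 1} \<and> v \<le> u \<and> u \<le> K * v"

lemma admissible_cases:
  assumes "admissible K u v"
  obtains "u = 0" "v = 0" | "1 \<le> u" "u \<le> K" "v = 1"
  using assms by (auto simp: admissible_def)

locale cover_inequality =
  fixes p :: "'i::finite \<Rightarrow> real" and K :: nat and C :: "'i set" and k :: "'i \<Rightarrow> nat"
  assumes K: "K \<ge> 2"
    and p: "\<And>i. 0 \<le> p i \<and> p i \<le> 1"
    and C: "C \<subseteq> idx_P p"
    and k: "\<And>i. i \<in> idx_P p - C \<Longrightarrow> k i \<in> {1..K - 1}"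
begin

text \<open>
  The weights split \<open>prod_compl p C\<close> over all items. For an item of \<open>C\<close> the reference value is
  \<open>(1 - p i)^1\<close>, attained when it is selected once; for the others it is \<open>(1 - p i)^0\<close>.
\<close>

definition w :: "'i \<Rightarrow> real" where
  "w i = (if i \<in> C then 1 - p i else 1)"

definition c :: "'i \<Rightarrow> real \<Rightarrow> real \<Rightarrow> real" where
  "c i u v = (if i \<in> C then p i * (u - v) else if p i = 1 then v else h_fun p i (k i) u v)"

definition lhs :: "real \<times> (real ^ 'i) \<times> (real ^ 'i) \<Rightarrow> real" where
  "lhs = (\<lambda>(\<eta>, y, z). \<eta> - prod_compl p C * (\<Sum>i\<in>UNIV. c i (y $ i) (z $ i)))"

definition pt :: "('i \<Rightarrow> nat) \<Rightarrow> ('i \<Rightarrow> nat) \<Rightarrow> real \<times> (real ^ 'i) \<times> (real ^ 'i)" where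
  "pt y z = (1 - (\<Prod>i\<in>UNIV. (1 - p i) ^ y i), (\<chi> i. real (y i)), (\<chi> i. real (z i)))"

definition tight_pts :: "(real \<times> (real ^ 'i) \<times> (real ^ 'i)) set" where
  "tight_pts = {x \<in> feas_set p K. lhs x = 1 - prod_compl p C}"

lemma p_C: "i \<in> C \<Longrightarrow> p i < 1"
  using C by (auto simp: idx_P_def)

lemma prod_w: "prod w UNIV = prod_compl p C"
  unfolding w_def prod_compl_def by (simp add: prod.If_cases)

lemma sum_c:
  "(\<Sum>i\<in>UNIV. c i (y i) (z i)) =
    (\<Sum>i\<in>idx_P p - C. h_fun p i (k i) (y i) (z i)) + (\<Sum>i\<in>C. p i * (y i - z i))
      + (\<Sum>i\<in>idx_F p. z i)"
proof -
  have U: "UNIV = (idx_P p - C) \<union> C \<union> idx_F p"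
    using p by (auto simp: idx_P_def idx_F_def less_le)
  have "(\<Sum>i\<in>UNIV. c i (y i) (z i)) =
      (\<Sum>i\<in>idx_P p - C. c i (y i) (z i)) + (\<Sum>i\<in>C. c i (y i) (z i))
        + (\<Sum>i\<in>idx_F p. c i (y i) (z i))"
    unfolding U using p_C
    by (subst sum.union_disjoint, simp, simp, force simp: idx_P_def idx_F_def)
       (subst sum.union_disjoint, auto)
  moreover have "(\<Sum>i\<in>idx_P p - C. c i (y i) (z i)) = (\<Sum>i\<in>idx_P p - C. h_fun p i (k i) (y i) (z i))"
    by (intro sum.cong) (auto simp: c_def idx_P_def)
  moreover have "(\<Sum>i\<in>C. c i (y i) (z i)) = (\<Sum>i\<in>C. p i * (y i - z i))"
    by (intro sum.cong) (auto simp: c_def)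
  moreover have "(\<Sum>i\<in>idx_F p. c i (y i) (z i)) = (\<Sum>i\<in>idx_F p. z i)"
    using p_C by (intro sum.cong) (fastforce simp: c_def idx_F_def)+
  ultimately show ?thesis by simp
qed

lemma linear_lhs: "linear lhs"
proof -
  have *: "c i (u + u') (v + v') = c i u v + c i u' v'" "c i (r * u) (r * v) = r * c i u v"
    for i u v u' v' r
    by (simp_all add: c_def h_fun_def algebra_simps)
  show ?thesis
    by (rule linearI)
       (auto simp: lhs_def * sum.distrib sum_distrib_left[symmetric] algebra_simps)
qed

lemma c_0 [simp]: "c i 0 0 = 0"
  by (simp add: c_def h_fun_def)

lemma c_outside:
  assumes "i \<notin> C" "p i \<noteq> 1"
  shows "c i (real u) 1 = 1 - (1 - p i) ^ k i * (1 + p i * (real (k i) - real u))"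
  using assms by (simp add: c_def h_fun_def algebra_simps)

text \<open>
  The chord used at an item outside \<open>C\<close> with \<open>p i < 1\<close> is the one at \<open>k i\<close>, at an item of \<open>C\<close> the one
  at \<open>1\<close>. At an item with \<open>p i = 1\<close> both sides of the second bound are \<open>0\<close> once it is selected.
\<close>

lemma term_bounds:
  assumes "admissible K u v"
  shows "0 \<le> c i (real u) (real v)"
    and "w i * (1 - c i (real u) (real v)) \<le> (1 - p i) ^ u"
proof -
  have pi: "0 \<le> p i" "p i \<le> 1" using p by auto
  from assms show "0 \<le> c i (real u) (real v)"
  proof (cases rule: admissible_cases)
    case 2
    have "(1 - p i) ^ u \<le> 1" using pi by (intro power_le_one) auto
    with 2 power_ge_chord[of "p i" "k i" u] pi show ?thesis
      by (cases "i \<in> C \<or> p i = 1") (auto simp: c_outside, auto simp: c_def)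
  qed simp
  from assms show "w i * (1 - c i (real u) (real v)) \<le> (1 - p i) ^ u"
  proof (cases rule: admissible_cases)
    case 1
    then show ?thesis using pi by (simp add: w_def)
  next
    case 2
    have "p i < 1" if "i \<in> C" using that p_C by auto
    with 2 power_ge_chord[of "p i" "k i" u] power_ge_chord[of "p i" 1 u] pi show ?thesis
      by (cases "i \<in> C"; cases "p i = 1") (auto simp: c_outside w_def, auto simp: c_def algebra_simps)
  qed
qed

lemma feas_set_iff:
  "x \<in> feas_set p K \<longleftrightarrow> (\<exists>\<eta> y z. x = (\<eta>, snd (pt y z)) \<and> \<eta> \<le> fst (pt y z)
    \<and> (\<forall>i. admissible K (y i) (z i)))"
  unfolding feas_set_def pt_def admissible_def by auto blast+

lemma lhs_valid:
  assumes "x \<in> feas_set p K"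
  shows "lhs x \<le> 1 - prod_compl p C"
proof -
  obtain \<eta> y z where x: "x = (\<eta>, snd (pt y z))" "\<eta> \<le> fst (pt y z)"
    and adm: "\<And>i. admissible K (y i) (z i)"
    using assms unfolding feas_set_iff by blast
  have "prod w UNIV * (1 - (\<Sum>i\<in>UNIV. c i (real (y i)) (real (z i)))) \<le> (\<Prod>i\<in>UNIV. (1 - p i) ^ y i)"
    using p adm term_bounds
    by (intro prod_ge_weighted_one_minus_sum) (auto simp: w_def)
  then show ?thesis
    using x by (simp add: lhs_def pt_def prod_w algebra_simps)
qed

section \<open>Tight points\<close>

definition base :: "'i \<Rightarrow> nat" where
  "base i = of_bool (i \<in> C)"

lemma base_admissible: "admissible K (base i) (base i)"
  using K by (simp add: base_def admissible_def)

lemma c_base [simp]: "c i (real (base i)) (real (base i)) = 0"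
  by (simp add: base_def c_def h_fun_def)

lemma power_base: "(1 - p i) ^ base i = w i"
  by (simp add: base_def w_def)

lemma pt_tight_iff:
  assumes "\<And>i. admissible K (y i) (z i)"
  shows "pt y z \<in> tight_pts \<longleftrightarrow> (\<Prod>i\<in>UNIV. (1 - p i) ^ y i) =
    prod w UNIV * (1 - (\<Sum>i\<in>UNIV. c i (real (y i)) (real (z i))))"
proof -
  have "pt y z \<in> feas_set p K"
    unfolding feas_set_iff using assms by (intro exI[of _ "fst (pt y z)"] exI[of _ y] exI[of _ z]) simp
  then show ?thesis
    by (auto simp: tight_pts_def lhs_def pt_def prod_w algebra_simps)
qed

text \<open>
  At the base point every term \<open>c i\<close> is \<open>0\<close> and every factor equals its weight. With only one item
  moved, the sum reduces to one term, Weierstrass' inequality is an equality, and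
  tightness depends on that item alone.
\<close>

lemma tight_one_change:
  assumes "admissible K a b" and "(1 - p j) ^ a = w j * (1 - c j (real a) (real b))"
  shows "pt (base(j := a)) (base(j := b)) \<in> tight_pts"
proof -
  have "(\<Prod>i\<in>UNIV. (1 - p i) ^ (base(j := a)) i) = (1 - p j) ^ a * prod w (UNIV - {j})"
    by (subst prod.remove[of _ j]) (auto simp: power_base intro!: prod.cong)
  moreover have "prod w UNIV = w j * prod w (UNIV - {j})"
    by (rule prod.remove) auto
  moreover have "(\<Sum>i\<in>UNIV. c i (real ((base(j := a)) i)) (real ((base(j := b)) i))) = c j (real a) (real b)"
    by (subst sum.remove[of _ j]) auto
  ultimately show ?thesis
    using assms base_admissible by (subst pt_tight_iff) auto
qed

text \<open>
  Both sides of the tightness equation are \<open>0\<close>: the factor of \<open>f\<close> vanishes and its term is \<open>1\<close>. So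
  item \<open>j\<close> can be dropped although \<open>(1 - p j)^0\<close> is in general strictly above its weight.
\<close>

lemma tight_sure_change:
  assumes "p f = 1" "j \<in> C"
  shows "pt (base(f := 1, j := 0)) (base(f := 1, j := 0)) \<in> tight_pts"
proof -
  have f: "f \<notin> C" using assms p_C by force
  have "(\<Prod>i\<in>UNIV. (1 - p i) ^ (base(f := 1, j := 0)) i) = 0"
    using assms f by (intro prod_zero) (auto intro!: bexI[of _ f])
  moreover have "c i (real ((base(f := 1, j := 0)) i)) (real ((base(f := 1, j := 0)) i)) = 0"
    if "i \<noteq> f" for i
    using that by (cases "i = j") auto
  then have "(\<Sum>i\<in>UNIV. c i (real ((base(f := 1, j := 0)) i)) (real ((base(f := 1, j := 0)) i))) = 1"
    using assms f by (subst sum.remove[of _ f]) (auto simp: c_def simp del: fun_upd_apply, auto)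
  ultimately show ?thesis
    using K base_admissible by (subst pt_tight_iff) (auto simp: admissible_def)
qed

lemma base_tight: "pt base base \<in> tight_pts"
  using tight_one_change[OF base_admissible, of j j for j] by (simp add: power_base)

text \<open>
  The \<open>\<eta>\<close>-axis is transversal to the hyperplane of equality. Adjoining it makes the \<open>\<eta>\<close>-coordinates
  of the tight points irrelevant, so that only differences of \<open>(y, z)\<close> have to be tracked.
\<close>

definition tight_span :: "(real \<times> (real ^ 'i) \<times> (real ^ 'i)) set" where
  "tight_span = span (insert (1, 0) ((\<lambda>x. x - pt base base) ` tight_pts))"

lemma tight_span_diff:
  assumes "x \<in> tight_pts" "x' \<in> tight_pts" "snd x - snd x' = d"
  shows "(0, d) \<in> tight_span"
proof -
  have "(0, d) = (x - pt base base) - (x' - pt base base) - (fst x - fst x') *\<^sub>R (1, 0)"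
    using assms(3) by (cases x; cases x') (auto simp: prod_eq_iff)
  also have "\<dots> \<in> tight_span"
    unfolding tight_span_def using assms(1,2)
    by (intro span_diff[OF span_diff] span_scale span_base) auto
  finally show ?thesis .
qed

text \<open>
  The two values are the endpoints \<open>k j\<close> and \<open>k j + 1\<close> of the chord, which are at most \<open>K\<close> because
  \<open>k j \<le> K - 1\<close>. If \<open>p j = 1\<close>, the values \<open>1\<close> and \<open>2\<close> serve, both giving the term \<open>1\<close> and the
  factor \<open>0\<close>.
\<close>

lemma outside_values:
  assumes "j \<notin> C"
  obtains a where "pt (base(j := a)) (base(j := 1)) \<in> tight_pts"
    and "pt (base(j := Suc a)) (base(j := 1)) \<in> tight_pts"
proof (cases "p j = 1")
  case True
  show ?thesis
    by (rule that[of 1]; rule tight_one_change)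
       (use True assms K in \<open>auto simp: admissible_def w_def c_def\<close>)
next
  case False
  then have "j \<in> idx_P p - C" using assms p[of j] by (auto simp: idx_P_def)
  then have kj: "1 \<le> k j" "k j \<le> K - 1" using k by auto
  show ?thesis
    by (rule that[of "k j"]; rule tight_one_change)
       (use False assms kj c_outside[OF assms False, of "k j"] c_outside[OF assms False, of "Suc (k j)"]
         in \<open>auto simp: admissible_def w_def\<close>)
qed

text \<open>
  For an item outside \<open>C\<close>, the two tight values at \<open>z = 1\<close> differ by the \<open>y\<close>-axis, and comparison with
  the base point then gives the \<open>z\<close>-axis. For an item of \<open>C\<close>, the values \<open>y = 2\<close> and \<open>y = 1\<close> give the
  \<open>y\<close>-axis; the \<open>z\<close>-axis requires a tight point with the item dropped, which only a selected
  item \<open>f\<close> with \<open>p f = 1\<close> permits in general.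
\<close>

lemma axes_in_tight_span:
  assumes F: "idx_F p \<noteq> {}"
  shows "(0, axis j 1, 0) \<in> tight_span" and "(0, 0, axis j 1) \<in> tight_span"
proof -
  have sub: "subspace tight_span" by (simp add: tight_span_def)
  have outside: "(0, axis i 1, 0) \<in> tight_span" "(0, 0, axis i 1) \<in> tight_span" if i: "i \<notin> C" for i
  proof -
    obtain a where a: "pt (base(i := a)) (base(i := 1)) \<in> tight_pts"
      "pt (base(i := Suc a)) (base(i := 1)) \<in> tight_pts"
      using outside_values[OF i] by blast
    have b: "base i = 0" using i by (simp add: base_def)
    show y: "(0, axis i 1, 0) \<in> tight_span"
      by (rule tight_span_diff[OF a(2,1)]) (auto simp: pt_def vec_eq_iff axis_def)
    have "(0, real a *\<^sub>R axis i 1, axis i 1) \<in> tight_span"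
      by (rule tight_span_diff[OF a(1) base_tight]) (auto simp: pt_def vec_eq_iff axis_def b)
    from subspace_diff[OF sub this subspace_scale[OF sub y, of "real a"]]
    show "(0, 0, axis i 1) \<in> tight_span" by simp
  qed
  have inside: "(0, axis j 1, 0) \<in> tight_span" "(0, 0, axis j 1) \<in> tight_span" if j: "j \<in> C"
  proof -
    have b: "base j = 1" using j by (simp add: base_def)
    have two: "pt (base(j := 2)) (base(j := 1)) \<in> tight_pts"
      using K j by (intro tight_one_change)
        (auto simp: admissible_def w_def c_def power2_eq_square algebra_simps)
    show y: "(0, axis j 1, 0) \<in> tight_span"
      by (rule tight_span_diff[OF two base_tight]) (auto simp: pt_def vec_eq_iff axis_def b)
    obtain f where f: "p f = 1" using F by (auto simp: idx_F_def)
    then have fC: "f \<notin> C" using p_C by force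
    then have bf: "base f = 0" by (simp add: base_def)
    have "(0, axis f 1 - axis j 1, axis f 1 - axis j 1) \<in> tight_span"
      by (rule tight_span_diff[OF tight_sure_change[OF f j] base_tight])
         (use fC j in \<open>auto simp: pt_def vec_eq_iff axis_def b bf\<close>)
    from subspace_diff[OF sub subspace_add[OF sub outside[OF fC]]
        subspace_add[OF sub this y]]
    show "(0, 0, axis j 1) \<in> tight_span" by simp
  qed
  show "(0, axis j 1, 0) \<in> tight_span" "(0, 0, axis j 1) \<in> tight_span"
    using outside inside by blast+
qed

lemma tight_span_UNIV:
  assumes "idx_F p \<noteq> {}"
  shows "tight_span = UNIV"
proof -
  have "(1, 0) \<in> tight_span"
    by (simp add: tight_span_def span_base)
  then have "Basis \<subseteq> tight_span"
    using axes_in_tight_span[OF assms]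
    by (auto simp: Basis_prod_def Basis_vec_def zero_prod_def)
  then have "span Basis \<subseteq> tight_span"
    by (intro span_minimal) (simp_all add: tight_span_def)
  then show ?thesis by auto
qed

end

theorem theorem4p5:
  fixes p :: "'i::finite \<Rightarrow> real" and K :: nat and C :: "'i set" and k :: "'i \<Rightarrow> nat"
  assumes "K \<ge> 2"
    and "\<And>i. 0 \<le> p i \<and> p i \<le> 1"
    and "C \<subseteq> idx_P p"
    and "\<And>i. i \<in> idx_P p - C \<Longrightarrow> k i \<in> {1..K - 1}"
    and "idx_F p \<noteq> {}"
  shows "facet_defining (convex hull (feas_set p K))
    (\<lambda>(\<eta>, y, z). \<eta>)
    (\<lambda>(\<eta>, y, z). 1 - prod_compl p C + prod_compl p C *
       ((\<Sum>i\<in>idx_P p - C. h_fun p i (k i) (y $ i) (z $ i))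
        + (\<Sum>i\<in>C. p i * (y $ i - z $ i))
        + (\<Sum>i\<in>idx_F p. z $ i)))"
proof -
  interpret cover_inequality p K C k
    using assms by unfold_locales auto
  let ?b = "1 - prod_compl p C"
  let ?g = "\<lambda>(\<eta>::real, y, z). ?b + prod_compl p C *
       ((\<Sum>i\<in>idx_P p - C. h_fun p i (k i) (y $ i) (z $ i))
        + (\<Sum>i\<in>C. p i * (y $ i - z $ i))
        + (\<Sum>i\<in>idx_F p. z $ i))"
  let ?f = "\<lambda>(\<eta>::real, y :: real ^ 'i, z :: real ^ 'i). \<eta>"
  have "lhs x - ?b = ?f x - ?g x" for x :: "real \<times> (real ^ 'i) \<times> (real ^ 'i)"
    by (cases x) (simp add: lhs_def sum_c)
  then have lhs: "lhs x \<le> ?b \<longleftrightarrow> ?f x \<le> ?g x" "lhs x = ?b \<longleftrightarrow> ?f x = ?g x" for x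
    by (smt (verit))+
  let ?x0 = "(fst (pt base base) - 1, snd (pt base base))"
  have base: "pt base base \<in> feas_set p K" "lhs (pt base base) = ?b"
    using base_tight by (auto simp: tight_pts_def)
  have "?x0 \<in> feas_set p K"
    unfolding feas_set_iff using base_admissible
    by (intro exI[of _ "fst (pt base base) - 1"] exI[of _ base]) simp
  moreover have "lhs ?x0 < ?b"
    using base(2) by (simp add: lhs_def case_prod_beta)
  moreover have "span (insert (1, 0) ((\<lambda>x. x - pt base base) ` {x \<in> feas_set p K. lhs x = ?b})) = UNIV"
    using tight_span_UNIV[OF assms(5)] by (simp add: tight_span_def tight_pts_def)
  ultimately have
    "\<forall>x \<in> convex hull feas_set p K. lhs x \<le> ?b"
    "{x \<in> convex hull feas_set p K. lhs x = ?b} facet_of (convex hull feas_set p K)"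
    using facet_of_convex_hull_linear[OF linear_lhs lhs_valid _ _ base] by blast+
  then show ?thesis
    unfolding facet_defining_def lhs by (rule conjI)
qed

end
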